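(* Let $X$ be a bounded geometry metric space. Then $X$ has the metric sparsification property if and only if $X$ has property $ULA_\mu$.
   Context: A metric space $X$ has bounded geometry if for all $R>0$ there is $N_R\in\mathbb{N}$ such that every closed ball of radius $R$ in $X$ has at most $N_R$ points. For $E\subseteq X$ and $R>0$: $N_R(E)=\{y\in X: d(y,E)\le R\}$ and $\partial_RE=N_R(E)\setminus E$. $ULA_\mu$: for all $R,\epsilon>0$ there exists $S>0$ such that for all probability measures $\mu$ on $X$ there exists a finite set $E\subseteq X$ with $\mathrm{diam}(E)\le S$ and $\mu(\partial_RE)<\epsilon\,\mu(E)$. Metric sparsification property: there exists $c>0$ such that for all $R>0$ there exists $S>0$ such that for every probability measure $\mu$ on $X$ there is a subset $\Omega\subseteq X$ with a decomposition $\Omega=\bigsqcup_i\Omega_i$ such that $\mu(\Omega)\ge c$; $\mathrm{diam}(\Omega_i)\le S$ for all $i$; and $d(\Omega_i,\Omega_j)>R$ for all $i\ne j$. *)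

theory Defs
  imports "HOL-Probability.Probability"
begin

text \<open>
  A metric space is given as a set \<open>X\<close> in a type of class \<open>metric_space\<close>, with the restricted
  distance; \<open>X = UNIV\<close> is allowed, and so is the empty space.
\<close>

definition bounded_geometry :: "'a::metric_space set \<Rightarrow> bool" where
  "bounded_geometry X \<longleftrightarrow>
     (\<forall>R>0. \<exists>N::nat. \<forall>x\<in>X. finite (cball x R \<inter> X) \<and> card (cball x R \<inter> X) \<le> N)"

text \<open>
  \<open>infdist y {} = 0\<close> by library convention, whereas \<open>d(y, {}) = \<infinity>\<close>;
  the guard makes the neighbourhood of the empty set empty.
\<close>

definition nbhd :: "'a::metric_space set \<Rightarrow> real \<Rightarrow> 'a set \<Rightarrow> 'a set" where
  "nbhd X R E = {y \<in> X. E \<noteq> {} \<and> infdist y E \<le> R}"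

definition bdry :: "'a::metric_space set \<Rightarrow> real \<Rightarrow> 'a set \<Rightarrow> 'a set" where
  "bdry X R E = nbhd X R E - E"

text \<open>
  Borel probability measures on \<open>X\<close>; the second conjunct implies \<open>space \<mu> = X\<close>. A space of bounded
  geometry is countable, so there every subset of \<open>X\<close> is measurable.
\<close>

definition prob_measure_on :: "'a::metric_space set \<Rightarrow> 'a measure \<Rightarrow> bool" where
  "prob_measure_on X \<mu> \<longleftrightarrow> prob_space \<mu> \<and> sets \<mu> = sets (restrict_space borel X)"

definition ULA_mu :: "'a::metric_space set \<Rightarrow> bool" where
  "ULA_mu X \<longleftrightarrow>
     (\<forall>R>0. \<forall>\<epsilon>>0. \<exists>S>0. \<forall>\<mu>. prob_measure_on X \<mu> \<longrightarrow>
        (\<exists>E\<subseteq>X. finite E \<and> diameter E \<le> S \<and> measure \<mu> (bdry X R E) < \<epsilon> * measure \<mu> E))"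

text \<open>
  The decomposition is the set \<open>P\<close> of its nonempty pieces (empty ones impose no condition).
  Nonemptiness, part of \<open>partition_on\<close>, matters because \<open>setdist\<close> is \<open>0\<close> on the empty set;
  \<open>bounded\<close> is required because \<open>diameter\<close> is a supremum of reals, which is unspecified
  for unbounded sets.
\<close>

definition metric_sparsification :: "'a::metric_space set \<Rightarrow> bool" where
  "metric_sparsification X \<longleftrightarrow>
     (\<exists>c>0. \<forall>R>0. \<exists>S>0. \<forall>\<mu>. prob_measure_on X \<mu> \<longrightarrow>
        (\<exists>\<Omega> P. \<Omega> \<subseteq> X \<and> partition_on \<Omega> P \<and> measure \<mu> \<Omega> \<ge> c \<and>
           (\<forall>A\<in>P. bounded A \<and> diameter A \<le> S) \<and>
           (\<forall>A\<in>P. \<forall>B\<in>P. A \<noteq> B \<longrightarrow> setdist A B > R)))"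

end

theory Submission
  imports Defs
begin

text \<open>
  From sparsification to \<open>ULA\<^sub>\<mu>\<close>: if no neighbourhood of radius \<open>kR\<close>, \<open>k < n\<close>, of a piece of a
  \<open>2nR\<close>-separated family satisfies the isoperimetric inequality, then the measure of that piece
  grows by the factor \<open>(1 + \<epsilon>)\<^sup>n\<close> on passing to the neighbourhood of radius \<open>nR\<close>. These
  neighbourhoods are disjoint, so if this happened to every piece, the total mass would
  exceed \<open>1\<close> for large \<open>n\<close>.

  Conversely, pieces are split off greedily: \<open>ULA\<^sub>\<mu>\<close> with \<open>\<epsilon> = 1\<close>, applied to \<open>\<mu>\<close> conditioned on
  the complement of the \<open>R\<close>-neighbourhood of the pieces already found, yields a further piece whose
  boundary costs at most as much mass as the piece gains. Restricting \<open>\<mu>\<close> beforehand to a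
  finite set of mass greater than \<open>1/2\<close> makes the procedure terminate, with pieces of total mass at
  least \<open>1/4\<close>.
\<close>

section \<open>Finiteness, countability and measurability under bounded geometry\<close>

lemma bounded_geometry_finite:
  fixes X :: "'a::metric_space set"
  assumes "bounded_geometry X" "A \<subseteq> X" "bounded A"
  shows "finite A"
proof (cases "A = {}")
  case False
  then obtain x where x: "x \<in> A" by blast
  obtain r where r: "\<forall>y\<in>A. dist x y \<le> r"
    using assms(3) bounded_any_center by metis
  \<comment> \<open>Bounded geometry controls positive radii only, and \<open>r\<close> is 0 when
    \<open>A\<close> is a singleton, say; hence the maximum with 1.\<close>
  have "A \<subseteq> cball x (max r 1) \<inter> X"
    using r assms(2) by fastforce
  moreover have "finite (cball x (max r 1) \<inter> X)"
    using assms(1,2) x unfolding bounded_geometry_def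
    by (meson less_max_iff_disj subsetD zero_less_one)
  ultimately show ?thesis by (rule finite_subset)
qed simp

lemma bounded_geometry_countable:
  fixes X :: "'a::metric_space set"
  assumes "bounded_geometry X"
  shows "countable X"
proof (cases "X = {}")
  case False
  then obtain x where x: "x \<in> X" by blast
  have "X = (\<Union>n::nat. cball x (real n) \<inter> X)"
    using real_arch_simple by auto
  moreover have "finite (cball x (real n) \<inter> X)" for n
    by (rule bounded_geometry_finite[OF assms]) (auto intro: bounded_subset[OF bounded_cball])
  then have "countable (\<Union>n::nat. cball x (real n) \<inter> X)"
    by (intro countable_UN) (auto intro: countable_finite)
  ultimately show ?thesis by simp
qed simp

text \<open>Countable sets are Borel in a metric space. Every measurability side condition below
  thereby reduces to an inclusion in \<open>X\<close>.\<close>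

lemma sets_prob_measure_on:
  fixes X :: "'a::metric_space set"
  assumes "bounded_geometry X" "prob_measure_on X \<mu>"
  shows "sets \<mu> = Pow X"
proof -
  have borel: "B \<in> sets borel" if "B \<subseteq> X" for B
    using countable_subset[OF that bounded_geometry_countable[OF assms(1)]]
    by (rule sets.countable[rotated]) simp
  have "sets (restrict_space borel X) = Pow X"
  proof
    show "sets (restrict_space borel X) \<subseteq> Pow X"
      unfolding sets_restrict_space by blast
    show "Pow X \<subseteq> sets (restrict_space borel X)"
    proof
      fix B assume "B \<in> Pow X"
      then have "B \<in> sets borel" "B = X \<inter> B" using borel by blast+
      then show "B \<in> sets (restrict_space borel X)"
        unfolding sets_restrict_space by (rule rev_image_eqI)
    qed
  qed
  then show ?thesis
    using assms(2) by (simp add: prob_measure_on_def)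
qed

text \<open>Continuity from below along the initial segments of an enumeration of \<open>A\<close>.
  It serves both directions: it reduces an infinite family of pieces to a finite one, and it bounds
  the greedy procedure.\<close>

lemma (in finite_measure) finite_set_measure_approx:
  assumes "countable A" "Pow A \<subseteq> sets M" "c < measure M A"
  obtains F where "finite F" "F \<subseteq> A" "c < measure M F"
proof (cases "A = {}")
  case True
  then show ?thesis using assms that[of "{}"] by auto
next
  case False
  let ?F = "\<lambda>n. from_nat_into A ` {..<n}"
  have sub: "?F n \<subseteq> A" for n
    using from_nat_into[OF False] by auto
  have un: "(\<Union>n. ?F n) = A"
  proof
    show "A \<subseteq> (\<Union>n. ?F n)"
    proof
      fix a assume "a \<in> A"
      then obtain n where "a = from_nat_into A n"
        using assms(1) by (metis from_nat_into_surj)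
      then show "a \<in> (\<Union>n. ?F n)" by blast
    qed
  qed (use sub in blast)
  have "(\<lambda>n. measure M (?F n)) \<longlonglongrightarrow> measure M (\<Union>n. ?F n)"
  proof (rule finite_Lim_measure_incseq)
    have "?F n \<in> sets M" for n using sub[of n] assms(2) by blast
    then show "range ?F \<subseteq> sets M" by blast
    show "incseq ?F" unfolding incseq_def by (intro allI impI image_mono) simp
  qed
  then have "\<forall>\<^sub>F n in sequentially. c < measure M (?F n)"
    using assms(3) un by (simp add: order_tendstoD)
  then obtain n where "c < measure M (?F n)"
    using eventually_happens'[OF sequentially_bot] by blast
  then show ?thesis using that[of "?F n"] sub by simp
qed

section \<open>Neighbourhoods and their diameters\<close>

lemma nbhd_subset [simp]: "nbhd X R E \<subseteq> X"
  by (auto simp: nbhd_def)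

lemma bdry_subset [simp]: "bdry X R E \<subseteq> X"
  by (auto simp: bdry_def nbhd_def)

text \<open>The infimum defining \<open>infdist\<close> is attained on a nonempty finite set; for
  empty \<open>E\<close> the guard in \<open>nbhd\<close> makes both sides empty.\<close>

lemma nbhd_finite:
  fixes X :: "'a::metric_space set"
  assumes "finite E"
  shows "nbhd X R E = {y \<in> X. \<exists>x\<in>E. dist y x \<le> R}"
proof -
  have "infdist y E \<le> R \<longleftrightarrow> (\<exists>x\<in>E. dist y x \<le> R)" if ne: "E \<noteq> {}" for y
  proof
    assume "infdist y E \<le> R"
    moreover obtain x where "x \<in> E" "infdist y E = dist y x"
      using Min_in[of "dist y ` E"] assms ne
      by (simp add: infdist_notempty cInf_eq_Min image_iff) blast
    ultimately show "\<exists>x\<in>E. dist y x \<le> R" by auto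
  next
    assume "\<exists>x\<in>E. dist y x \<le> R"
    then show "infdist y E \<le> R" using infdist_le2 by blast
  qed
  then show ?thesis by (auto simp: nbhd_def)
qed

lemma finite_nbhd:
  fixes X :: "'a::metric_space set"
  assumes "bounded_geometry X" "finite E"
  shows "finite (nbhd X R E)"
proof -
  have "nbhd X R E \<subseteq> (\<Union>x\<in>E. cball x R)"
    using assms(2) by (auto simp: nbhd_finite dist_commute)
  moreover have "bounded (\<Union>x\<in>E. cball x R)"
    using assms(2) by auto
  ultimately show ?thesis
    using bounded_geometry_finite[OF assms(1) nbhd_subset] bounded_subset by blast
qed

lemma diameter_nbhd_le:
  fixes X :: "'a::metric_space set"
  assumes "finite E" "0 \<le> R"
  shows "diameter (nbhd X R E) \<le> diameter E + 2 * R"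
proof (cases "nbhd X R E = {}")
  case True
  then show ?thesis
    using assms diameter_ge_0[of E] by (simp add: finite_imp_bounded)
next
  case False
  have "dist y z \<le> diameter E + 2 * R" if yz: "y \<in> nbhd X R E" "z \<in> nbhd X R E" for y z
  proof -
    obtain a b where ab: "a \<in> E" "b \<in> E" "dist y a \<le> R" "dist z b \<le> R"
      using yz assms(1) by (auto simp: nbhd_finite)
    have "dist a b \<le> diameter E"
      using ab assms(1) diameter_bounded_bound finite_imp_bounded by blast
    moreover have "dist y z \<le> dist y a + dist a b + dist z b"
      by (metis add.commute add_left_mono dist_commute dist_triangle dist_triangle_le)
    ultimately show ?thesis using ab by linarith
  qed
  then show ?thesis
    using False by (subst diameter_def) (auto intro!: cSUP_least)
qed

text \<open>Bounded geometry makes the inner neighbourhood finite, so distances to it are attained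
  as well and the triangle inequality applies to actual points.\<close>

lemma nbhd_nbhd_subset:
  fixes X :: "'a::metric_space set"
  assumes "bounded_geometry X" "finite E"
  shows "nbhd X R (nbhd X T E) \<subseteq> nbhd X (T + R) E"
proof
  fix y assume "y \<in> nbhd X R (nbhd X T E)"
  then obtain z x where "y \<in> X" "x \<in> E" "dist y z \<le> R" "dist z x \<le> T"
    using assms finite_nbhd[OF assms] by (auto simp: nbhd_finite)
  then have "y \<in> X" "x \<in> E" "dist y x \<le> T + R"
    using dist_triangle[of y x z] by auto
  then show "y \<in> nbhd X (T + R) E"
    using assms(2) by (auto simp: nbhd_finite)
qed

lemma subset_nbhd:
  assumes "E \<subseteq> X" "0 \<le> R"
  shows "E \<subseteq> nbhd X R E"
  using assms by (auto simp: nbhd_def)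

lemma nbhd_disjoint:
  assumes "setdist A B > 2 * T"
  shows "nbhd X T A \<inter> nbhd X T B = {}"
proof -
  have False if "y \<in> nbhd X T A" "y \<in> nbhd X T B" for y
    using that assms setdist_triangle[of A B y]
    by (auto simp: nbhd_def infdist_eq_setdist setdist_sym)
  then show ?thesis by blast
qed

section \<open>From sparsification to isoperimetric sets\<close>

lemma measure_nbhd_growth:
  fixes X :: "'a::metric_space set"
  assumes X: "bounded_geometry X" and mu: "prob_measure_on X \<mu>"
    and A: "finite A" "A \<subseteq> X" and R: "0 < R" and eps: "0 < \<epsilon>"
    and no: "\<And>k. k < n \<Longrightarrow>
      \<epsilon> * measure \<mu> (nbhd X (real k * R) A) \<le> measure \<mu> (bdry X R (nbhd X (real k * R) A))"
  shows "(1 + \<epsilon>) ^ n * measure \<mu> A \<le> measure \<mu> (nbhd X (real n * R) A)"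
  using no
proof (induction n)
  interpret prob_space \<mu> using mu by (simp add: prob_measure_on_def)
  note sets = sets_prob_measure_on[OF X mu]
  {
    case 0
    show ?case
      using subset_nbhd[OF A(2), of 0] sets by (simp add: finite_measure_mono)
  next
    case (Suc n)
    let ?E = "nbhd X (real n * R) A"
    have "(1 + \<epsilon>) ^ Suc n * measure \<mu> A \<le> (1 + \<epsilon>) * measure \<mu> ?E"
      using Suc eps by (simp add: mult.assoc)
    \<comment> \<open>The assumed failure at radius \<open>n * R\<close> enters here. A set is
      disjoint from its boundary, so the masses add up, and the union stays within radius
      \<open>(n + 1) * R\<close>.\<close>
    also have "\<dots> \<le> measure \<mu> ?E + measure \<mu> (bdry X R ?E)"
      using Suc.prems[of n] by (simp add: algebra_simps)
    also have "\<dots> = measure \<mu> (?E \<union> bdry X R ?E)"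
      using sets by (intro finite_measure_Union[symmetric]) (simp_all, auto simp: bdry_def)
    also have "\<dots> \<le> measure \<mu> (nbhd X (real (Suc n) * R) A)"
    proof (rule finite_measure_mono)
      have "?E \<subseteq> nbhd X R ?E"
        using R by (intro subset_nbhd nbhd_subset) simp
      then show "?E \<union> bdry X R ?E \<subseteq> nbhd X (real (Suc n) * R) A"
        using nbhd_nbhd_subset[OF X A(1), of R "real n * R"]
        by (auto simp: bdry_def algebra_simps)
    qed (use sets in simp)
    finally show ?case .
  }
qed

text \<open>\<open>sep\<close> is the separation at which the neighbourhoods of radius
  \<open>n * R\<close> are disjoint, so their masses sum to at most 1; \<open>big\<close>
  contradicts this once the growth estimate is summed over \<open>P\<close>.\<close>

lemma separated_family_isoperimetric:
  fixes X :: "'a::metric_space set"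
  assumes X: "bounded_geometry X" and mu: "prob_measure_on X \<mu>"
    and P: "finite P" "\<And>A. A \<in> P \<Longrightarrow> finite A \<and> A \<subseteq> X"
    and sep: "\<And>A B. A \<in> P \<Longrightarrow> B \<in> P \<Longrightarrow> A \<noteq> B \<Longrightarrow> setdist A B > 2 * (real n * R)"
    and R: "0 < R" and eps: "0 < \<epsilon>"
    and big: "1 < (1 + \<epsilon>) ^ n * measure \<mu> (\<Union>P)"
  shows "\<exists>A\<in>P. \<exists>k<n. measure \<mu> (bdry X R (nbhd X (real k * R) A))
                      < \<epsilon> * measure \<mu> (nbhd X (real k * R) A)"
proof (rule ccontr)
  assume "\<not> ?thesis"
  then have no: "\<epsilon> * measure \<mu> (nbhd X (real k * R) A) \<le> measure \<mu> (bdry X R (nbhd X (real k * R) A))"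
    if "A \<in> P" "k < n" for A k
    using that by (meson not_less)
  interpret prob_space \<mu> using mu by (simp add: prob_measure_on_def)
  note sets = sets_prob_measure_on[OF X mu]
  have "(1 + \<epsilon>) ^ n * measure \<mu> (\<Union>P) \<le> (1 + \<epsilon>) ^ n * (\<Sum>A\<in>P. measure \<mu> A)"
    using finite_measure_subadditive_finite[OF P(1), of "\<lambda>A. A"] P(2) sets eps
    by (intro mult_left_mono) auto
  also have "\<dots> = (\<Sum>A\<in>P. (1 + \<epsilon>) ^ n * measure \<mu> A)"
    by (simp add: sum_distrib_left)
  also have "\<dots> \<le> (\<Sum>A\<in>P. measure \<mu> (nbhd X (real n * R) A))"
    using P(2) no by (intro sum_mono measure_nbhd_growth[OF X mu _ _ R eps]) auto
  also have "\<dots> = measure \<mu> (\<Union>A\<in>P. nbhd X (real n * R) A)"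
    using P(1) sets nbhd_disjoint[OF sep]
    by (intro finite_measure_finite_Union[symmetric])
       (simp_all add: disjoint_family_on_def image_subset_iff)
  also have "\<dots> \<le> 1" by (rule prob_le_1)
  finally show False using big by simp
qed

text \<open>The order of quantifiers is decisive: \<open>c\<close> does not depend on the separation
  scale, so \<open>n\<close> can be chosen from \<open>c\<close> and \<epsilon> first and the scale
  from \<open>n\<close> afterwards.\<close>

lemma metric_sparsification_imp_ULA_mu:
  fixes X :: "'a::metric_space set"
  assumes X: "bounded_geometry X" and msp: "metric_sparsification X"
  shows "ULA_mu X"
  unfolding ULA_mu_def
proof (intro allI impI)
  fix R \<epsilon> :: real
  assume R: "R > 0" and eps: "\<epsilon> > 0"
  obtain c where c: "c > 0"
    and msp': "\<forall>R>0. \<exists>S>0. \<forall>\<mu>. prob_measure_on X \<mu> \<longrightarrow>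
        (\<exists>\<Omega> P. \<Omega> \<subseteq> X \<and> partition_on \<Omega> P \<and> measure \<mu> \<Omega> \<ge> c \<and>
           (\<forall>A\<in>P. bounded A \<and> diameter A \<le> S) \<and>
           (\<forall>A\<in>P. \<forall>B\<in>P. A \<noteq> B \<longrightarrow> setdist A B > R))"
    using msp unfolding metric_sparsification_def by (elim exE conjE) (rule that)
  \<comment> \<open>Calibrated for mass \<open>c / 2\<close> rather than \<open>c\<close>, since
    half of \<open>c\<close> is given up on passing to finitely many pieces.\<close>
  obtain n where n: "2 / c < (1 + \<epsilon>) ^ n"
    using real_arch_pow[of "1 + \<epsilon>"] eps by auto
  \<comment> \<open>The summand 1 keeps the scale positive even if \<open>n\<close> is 0.\<close>
  define R' where "R' = 2 * (real n * R) + 1"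
  have "R' > 0" using R by (simp add: R'_def add_nonneg_pos)
  from msp'[rule_format, OF this] obtain S where S: "S > 0"
    and sp: "\<forall>\<mu>. prob_measure_on X \<mu> \<longrightarrow>
        (\<exists>\<Omega> P. \<Omega> \<subseteq> X \<and> partition_on \<Omega> P \<and> measure \<mu> \<Omega> \<ge> c \<and>
           (\<forall>A\<in>P. bounded A \<and> diameter A \<le> S) \<and>
           (\<forall>A\<in>P. \<forall>B\<in>P. A \<noteq> B \<longrightarrow> setdist A B > R'))"
    by (elim exE conjE) (rule that)
  show "\<exists>S>0. \<forall>\<mu>. prob_measure_on X \<mu> \<longrightarrow>
        (\<exists>E\<subseteq>X. finite E \<and> diameter E \<le> S \<and> measure \<mu> (bdry X R E) < \<epsilon> * measure \<mu> E)"
  \<comment> \<open>The set found will be a neighbourhood, of radius at most \<open>n * R\<close>,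
    of a piece of diameter at most \<open>S\<close>.\<close>
  proof (intro exI[of _ "S + 2 * (real n * R)"] conjI allI impI)
    show "S + 2 * (real n * R) > 0" using S R by (simp add: add_pos_nonneg)
    fix \<mu> :: "'a measure" assume mu: "prob_measure_on X \<mu>"
    interpret prob_space \<mu> using mu by (simp add: prob_measure_on_def)
    note sets = sets_prob_measure_on[OF X mu]
    obtain \<Omega> P where Om: "\<Omega> \<subseteq> X" "partition_on \<Omega> P" "measure \<mu> \<Omega> \<ge> c"
      and P: "\<And>A. A \<in> P \<Longrightarrow> bounded A \<and> diameter A \<le> S"
      and sep: "\<And>A B. A \<in> P \<Longrightarrow> B \<in> P \<Longrightarrow> A \<noteq> B \<Longrightarrow> setdist A B > R'"
      using sp[rule_format, OF mu] by (elim exE conjE) (rule that, auto)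
    have Un: "\<Union>P = \<Omega>" using Om(2) by (simp add: partition_on_def)
    have PX: "finite A \<and> A \<subseteq> X" if "A \<in> P" for A
      using that P Un Om(1) bounded_geometry_finite[OF X] by blast
    have "countable \<Omega>" "Pow \<Omega> \<subseteq> sets \<mu>" "c / 2 < measure \<mu> \<Omega>"
      using Om c sets countable_subset[OF Om(1) bounded_geometry_countable[OF X]] by auto
    then obtain F where F: "finite F" "F \<subseteq> \<Omega>" "c / 2 < measure \<mu> F"
      by (rule finite_set_measure_approx)
    \<comment> \<open>\<open>P\<close> may be infinite; finitely many pieces already cover
      \<open>F\<close>, hence have mass above \<open>c / 2\<close>.\<close>
    obtain Q where Q: "finite Q" "Q \<subseteq> P" "F \<subseteq> \<Union>Q"
      using finite_subset_Union[of F P] F Un by blast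
    have "1 = 2 / c * (c / 2)" using c by simp
    also have "\<dots> < (1 + \<epsilon>) ^ n * measure \<mu> F"
      using n F(3) c by (intro mult_strict_mono') auto
    also have "\<dots> \<le> (1 + \<epsilon>) ^ n * measure \<mu> (\<Union>Q)"
      using Q PX sets eps by (intro mult_left_mono finite_measure_mono) auto
    finally have big: "1 < (1 + \<epsilon>) ^ n * measure \<mu> (\<Union>Q)" .
    have "\<exists>A\<in>Q. \<exists>k<n. measure \<mu> (bdry X R (nbhd X (real k * R) A))
                      < \<epsilon> * measure \<mu> (nbhd X (real k * R) A)"
    proof (rule separated_family_isoperimetric[OF X mu Q(1) _ _ R eps big])
      show "setdist A B > 2 * (real n * R)" if "A \<in> Q" "B \<in> Q" "A \<noteq> B" for A B
        using sep[of A B] that subsetD[OF Q(2)] by (simp add: R'_def)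
    qed (use Q PX in auto)
    then obtain A k where A: "A \<in> P" and k: "k < n"
      and less: "measure \<mu> (bdry X R (nbhd X (real k * R) A))
                      < \<epsilon> * measure \<mu> (nbhd X (real k * R) A)"
      using Q(2) by blast
    have "diameter (nbhd X (real k * R) A) \<le> diameter A + 2 * (real k * R)"
      using PX[OF A] R by (intro diameter_nbhd_le) auto
    also have "\<dots> \<le> S + 2 * (real n * R)"
      using P[OF A] k R by (intro add_mono mult_left_mono mult_right_mono) auto
    finally show "\<exists>E\<subseteq>X. finite E \<and> diameter E \<le> S + 2 * (real n * R)
        \<and> measure \<mu> (bdry X R E) < \<epsilon> * measure \<mu> E"
      using less PX[OF A] finite_nbhd[OF X]
      by (intro exI[of _ "nbhd X (real k * R) A"]) simp
  qed
qed

section \<open>From isoperimetric sets to sparsification\<close>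

lemma prob_measure_on_uniform_measure:
  assumes "prob_measure_on X \<mu>" "measure \<mu> D > 0"
  shows "prob_measure_on X (uniform_measure \<mu> D)"
proof -
  interpret prob_space \<mu> using assms(1) by (simp add: prob_measure_on_def)
  show ?thesis
    using assms by (auto simp: prob_measure_on_def emeasure_eq_measure
        intro!: prob_space_uniform_measure)
qed

text \<open>The distance is attained at one of finitely many pairs, so the strict bound survives the
  infimum.\<close>

lemma setdist_finite_gt:
  fixes A B :: "'a::metric_space set"
  assumes "finite A" "finite B" "A \<noteq> {}" "B \<noteq> {}" "\<And>x y. x \<in> A \<Longrightarrow> y \<in> B \<Longrightarrow> R < dist x y"
  shows "R < setdist A B"
proof -
  let ?D = "(\<lambda>(x, y). dist x y) ` (A \<times> B)"
  have "finite ?D" "?D \<noteq> {}" using assms(1-4) by auto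
  moreover have "setdist A B = Inf ?D"
    using assms(3,4) by (simp add: setdist_def) (rule arg_cong[where f = Inf], auto)
  ultimately have "setdist A B \<in> ?D"
    using Min_in by (metis cInf_eq_Min)
  then show ?thesis using assms(5) by auto
qed

text \<open>\<open>cost\<close> is the invariant of the procedure: within \<open>F\<close>, the set
  found so far carries at least half the mass of its neighbourhood. The new piece avoids that
  neighbourhood, hence is farther than \<open>R\<close> from \<open>U\<close>.\<close>

lemma greedy_step:
  fixes X :: "'a::metric_space set"
  assumes X: "bounded_geometry X" and mu: "prob_measure_on X \<mu>"
    and ula: "\<forall>\<nu>. prob_measure_on X \<nu> \<longrightarrow>
        (\<exists>E\<subseteq>X. finite E \<and> diameter E \<le> S \<and> measure \<nu> (bdry X R E) < measure \<nu> E)"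
    and R: "0 < R" and F: "F \<subseteq> X" and U: "U \<subseteq> X" "finite U"
    and cost: "measure \<mu> (F \<inter> nbhd X R U) \<le> 2 * measure \<mu> (F \<inter> U)"
    and rest: "measure \<mu> (F - nbhd X R U) > 0"
  obtains E where "E \<subseteq> X" "finite E" "diameter E \<le> S" "E \<inter> nbhd X R U = {}" "F \<inter> E \<noteq> {}"
    "measure \<mu> (F \<inter> nbhd X R (U \<union> E)) \<le> 2 * measure \<mu> (F \<inter> (U \<union> E))"
proof -
  interpret prob_space \<mu> using mu by (simp add: prob_measure_on_def)
  note sets = sets_prob_measure_on[OF X mu]
  let ?N = "nbhd X R U"
  define D where "D = F - ?N"
  have D: "D \<subseteq> X" "measure \<mu> D > 0" using F rest by (auto simp: D_def)
  obtain E where E: "E \<subseteq> X" "finite E" "diameter E \<le> S"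
    and less: "measure (uniform_measure \<mu> D) (bdry X R E) < measure (uniform_measure \<mu> D) E"
    using ula prob_measure_on_uniform_measure[OF mu D(2)] by blast
  have "measure (uniform_measure \<mu> D) B = measure \<mu> (D \<inter> B) / measure \<mu> D" if "B \<subseteq> X" for B
    using that sets D by (intro measure_uniform_measure) (auto simp: emeasure_eq_measure)
  \<comment> \<open>Clearing the common denominator turns the inequality for the conditioned measure
    into one for \<mu> inside \<open>D\<close>.\<close>
  then have iso: "measure \<mu> (D \<inter> bdry X R E) < measure \<mu> (D \<inter> E)"
    using less D(2) E(1) by (simp add: divide_less_cancel)
  show ?thesis
  \<comment> \<open>Cutting away \<open>?N\<close> ensures separation and loses nothing of
    \<open>D \<inter> E\<close>, as \<open>D\<close> avoids \<open>?N\<close>.\<close>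
  proof (rule that[of "E - ?N"])
    show "diameter (E - ?N) \<le> S"
      using diameter_subset[of "E - ?N" E] E by (simp add: finite_imp_bounded)
    have "D \<inter> E \<noteq> {}"
      using iso measure_nonneg[of \<mu> "D \<inter> bdry X R E"] by (metis measure_empty not_less)
    then show "F \<inter> (E - ?N) \<noteq> {}" by (auto simp: D_def)
    \<comment> \<open>A point of \<open>F\<close> outside \<open>?N\<close> lies in
      \<open>D\<close>; if it is within \<open>R\<close> of the new piece, it is in \<open>E\<close>
      or in the boundary of \<open>E\<close>.\<close>
    have "F \<inter> nbhd X R (U \<union> (E - ?N)) \<subseteq> (F \<inter> ?N) \<union> ((D \<inter> E) \<union> (D \<inter> bdry X R E))"
      using U(2) E(2) by (auto simp: nbhd_finite bdry_def D_def)
    then have "measure \<mu> (F \<inter> nbhd X R (U \<union> (E - ?N)))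
        \<le> measure \<mu> ((F \<inter> ?N) \<union> ((D \<inter> E) \<union> (D \<inter> bdry X R E)))"
      using sets F D by (intro finite_measure_mono) auto
    also have "\<dots> \<le> measure \<mu> (F \<inter> ?N) + measure \<mu> ((D \<inter> E) \<union> (D \<inter> bdry X R E))"
      using sets F D by (intro measure_Un_le) auto
    also have "\<dots> \<le> measure \<mu> (F \<inter> ?N) + (measure \<mu> (D \<inter> E) + measure \<mu> (D \<inter> bdry X R E))"
      using sets D by (intro add_left_mono measure_Un_le) auto
    also have "\<dots> \<le> 2 * (measure \<mu> (F \<inter> U) + measure \<mu> (D \<inter> E))"
      using iso cost by simp
    also have "measure \<mu> (F \<inter> U) + measure \<mu> (D \<inter> E) = measure \<mu> ((F \<inter> U) \<union> (D \<inter> E))"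
      using sets F D subset_nbhd[OF U(1), of R] R
      by (intro finite_measure_Union[symmetric]) (auto simp: D_def)
    also have "\<dots> \<le> measure \<mu> (F \<inter> (U \<union> (E - ?N)))"
      using sets F by (intro finite_measure_mono) (auto simp: D_def)
    finally show "measure \<mu> (F \<inter> nbhd X R (U \<union> (E - ?N)))
        \<le> 2 * measure \<mu> (F \<inter> (U \<union> (E - ?N)))" by simp
  qed (use E in auto)
qed

lemma ULA_mu_imp_metric_sparsification:
  fixes X :: "'a::metric_space set"
  assumes X: "bounded_geometry X" and ula: "ULA_mu X"
  shows "metric_sparsification X"
  unfolding metric_sparsification_def
\<comment> \<open>One factor 1/2 comes from restricting to a finite \<open>F\<close>, the other from
  the factor 2 in the cost inequality.\<close>
proof (rule exI[of _ "1/4"], intro conjI allI impI)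
  fix R :: real assume R: "R > 0"
  obtain S where S: "S > 0"
    and step: "\<forall>\<nu>. prob_measure_on X \<nu> \<longrightarrow>
        (\<exists>E\<subseteq>X. finite E \<and> diameter E \<le> S \<and> measure \<nu> (bdry X R E) < measure \<nu> E)"
    using ula[unfolded ULA_mu_def, rule_format, OF R zero_less_one] by auto
  have "\<exists>\<Omega> P. \<Omega> \<subseteq> X \<and> partition_on \<Omega> P \<and> measure \<mu> \<Omega> \<ge> 1/4 \<and>
           (\<forall>A\<in>P. bounded A \<and> diameter A \<le> S) \<and>
           (\<forall>A\<in>P. \<forall>B\<in>P. A \<noteq> B \<longrightarrow> setdist A B > R)"
    if mu: "prob_measure_on X \<mu>" for \<mu>
  proof -
    interpret prob_space \<mu> using mu by (simp add: prob_measure_on_def)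
    note sets = sets_prob_measure_on[OF X mu]
    have "space \<mu> = X"
      using sets by (metis Pow_iff Pow_top sets.sets_into_space sets.top subset_antisym)
    then have "1/2 < measure \<mu> X" using prob_space by simp
    then obtain F where F: "finite F" "F \<subseteq> X" "1/2 < measure \<mu> F"
      using finite_set_measure_approx[OF bounded_geometry_countable[OF X], of "1/2"] sets by auto
    \<comment> \<open>Separation is stated pointwise, which is easy to extend by one piece; it
      becomes a bound on \<open>setdist\<close> only at the end.\<close>
    define good where "good P \<longleftrightarrow> finite P \<and>
        (\<forall>A\<in>P. A \<subseteq> X \<and> finite A \<and> A \<noteq> {} \<and> diameter A \<le> S) \<and>
        (\<forall>A\<in>P. \<forall>B\<in>P. A \<noteq> B \<longrightarrow> (\<forall>x\<in>A. \<forall>y\<in>B. R < dist x y)) \<and>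
        measure \<mu> (F \<inter> nbhd X R (\<Union>P)) \<le> 2 * measure \<mu> (F \<inter> \<Union>P)" for P
    \<comment> \<open>The neighbourhood of the empty set is empty, so both sides of the cost
      inequality vanish.\<close>
    have "good {}" by (simp add: good_def nbhd_def)
    \<comment> \<open>Instead of iterating, take a good family covering the most points of
      \<open>F\<close>; the count is bounded by \<open>card F\<close>.\<close>
    moreover have "\<forall>P. good P \<longrightarrow> card (F \<inter> \<Union>P) < Suc (card F)"
      using F(1) by (simp add: less_Suc_eq_le card_mono)
    ultimately have "\<exists>P. good P \<and> (\<forall>Q. good Q \<longrightarrow> card (F \<inter> \<Union>Q) \<le> card (F \<inter> \<Union>P))"
      by (rule ex_has_greatest_nat[where f = "\<lambda>P. card (F \<inter> \<Union>P)"])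
    then obtain P where P: "good P"
      and max: "\<forall>Q. good Q \<longrightarrow> card (F \<inter> \<Union>Q) \<le> card (F \<inter> \<Union>P)"
      by (elim exE conjE) (rule that)
    define U where "U = \<Union>P"
    have U: "U \<subseteq> X" "finite U" using P by (auto simp: good_def U_def)
    have cost: "measure \<mu> (F \<inter> nbhd X R U) \<le> 2 * measure \<mu> (F \<inter> U)"
      using P by (simp add: good_def U_def)
    \<comment> \<open>Otherwise a further piece could be added, and it would cover new points of
      \<open>F\<close>, against maximality.\<close>
    have "measure \<mu> (F - nbhd X R U) = 0"
    proof (rule ccontr)
      assume "measure \<mu> (F - nbhd X R U) \<noteq> 0"
      then have "measure \<mu> (F - nbhd X R U) > 0" by (simp add: zero_less_measure_iff)
      then obtain E where E: "E \<subseteq> X" "finite E" "diameter E \<le> S" "E \<inter> nbhd X R U = {}"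
        "F \<inter> E \<noteq> {}"
        "measure \<mu> (F \<inter> nbhd X R (U \<union> E)) \<le> 2 * measure \<mu> (F \<inter> (U \<union> E))"
        by (rule greedy_step[OF X mu step R F(2) U cost])
      have far: "R < dist x y" if "x \<in> E" "y \<in> U" for x y
        using that E(1,4) U(2) by (force simp: nbhd_finite)
      have far': "R < dist y x" if "x \<in> E" "y \<in> U" for x y
        using far[OF that] by (simp add: dist_commute)
      have "good (insert E P)"
        unfolding good_def
      proof (intro conjI)
        show "finite (insert E P)" using P by (simp add: good_def)
        show "\<forall>A\<in>insert E P. A \<subseteq> X \<and> finite A \<and> A \<noteq> {} \<and> diameter A \<le> S"
          using P E by (auto simp: good_def)
        have "\<forall>A\<in>P. \<forall>B\<in>P. A \<noteq> B \<longrightarrow> (\<forall>x\<in>A. \<forall>y\<in>B. R < dist x y)"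
          using P by (simp add: good_def)
        moreover have "\<forall>A\<in>P. \<forall>x\<in>E. \<forall>y\<in>A. R < dist x y \<and> R < dist y x"
          using far far' unfolding U_def by blast
        ultimately show "\<forall>A\<in>insert E P. \<forall>B\<in>insert E P. A \<noteq> B \<longrightarrow>
            (\<forall>x\<in>A. \<forall>y\<in>B. R < dist x y)"
          by simp
        show "measure \<mu> (F \<inter> nbhd X R (\<Union>(insert E P))) \<le> 2 * measure \<mu> (F \<inter> \<Union>(insert E P))"
          using E(6) by (simp add: U_def Un_commute)
      qed
      from max[rule_format, OF this] have "card (F \<inter> (E \<union> U)) \<le> card (F \<inter> U)" by (simp add: U_def)
      moreover have "F \<inter> U \<subset> F \<inter> (E \<union> U)"
        using E(4,5) subset_nbhd[OF U(1), of R] R by fastforce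
      ultimately show False
        using psubset_card_mono[of "F \<inter> (E \<union> U)" "F \<inter> U"] F(1) by auto
    qed
    moreover have "measure \<mu> F \<le> measure \<mu> (F \<inter> nbhd X R U) + measure \<mu> (F - nbhd X R U)"
      using measure_Un_le[of "F \<inter> nbhd X R U" \<mu> "F - nbhd X R U"] sets F(2)
      by (auto simp: Int_Diff_Un)
    moreover have "measure \<mu> (F \<inter> U) \<le> measure \<mu> U"
      using sets U by (intro finite_measure_mono) auto
    \<comment> \<open>Up to a null set \<open>F\<close> lies in the neighbourhood of
      \<open>U\<close>, so \<open>cost\<close> gives \<open>U\<close> at least half the mass of
      \<open>F\<close>.\<close>
    ultimately have "measure \<mu> U \<ge> 1/4" using cost F(3) by linarith
    moreover have "A \<inter> B = {}" if "A \<in> P" "B \<in> P" "A \<noteq> B" for A B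
    proof -
      have "R < dist x x" if "x \<in> A" "x \<in> B" for x
        using P \<open>A \<in> P\<close> \<open>B \<in> P\<close> \<open>A \<noteq> B\<close> that unfolding good_def by blast
      then show ?thesis using R by auto
    qed
    then have "partition_on U P"
      using P by (auto simp: partition_on_def U_def good_def disjoint_def)
    moreover have "setdist A B > R" if "A \<in> P" "B \<in> P" "A \<noteq> B" for A B
      using P that by (intro setdist_finite_gt) (auto simp: good_def)
    moreover have "bounded A \<and> diameter A \<le> S" if "A \<in> P" for A
      using P that by (auto simp: good_def finite_imp_bounded)
    ultimately show ?thesis
      using U(1) by (intro exI[of _ U] exI[of _ P]) simp
  qed
  then show "\<exists>S>0. \<forall>\<mu>. prob_measure_on X \<mu> \<longrightarrow>
        (\<exists>\<Omega> P. \<Omega> \<subseteq> X \<and> partition_on \<Omega> P \<and> measure \<mu> \<Omega> \<ge> 1/4 \<and>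
           (\<forall>A\<in>P. bounded A \<and> diameter A \<le> S) \<and>
           (\<forall>A\<in>P. \<forall>B\<in>P. A \<noteq> B \<longrightarrow> setdist A B > R))"
    using S by (intro exI[of _ S]) simp
qed simp

theorem theorem3p8:
  fixes X :: "'a::metric_space set"
  assumes "bounded_geometry X"
  shows "metric_sparsification X \<longleftrightarrow> ULA_mu X"
  using assms metric_sparsification_imp_ULA_mu ULA_mu_imp_metric_sparsification by blast

end
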